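(* Let $X$ be an $\mathbb{F}_2$-Grassmannian complex (of rank at least $1$) in ambient vector space $\mathbb{F}_2^k=\mathrm{span}\,X(0)$, such that all vertices $x_0\in X(0)$ have the same weight. Let $\lambda=\lambda^{(-1)}(X)$ and assume $\lambda<1$. Let $G_X\in\mathbb{F}_2^{X(0)\times k}$ be the matrix whose row indexed by $x_0\in X(0)$ is the vector $x_0$. Then the Hamming weight $|c|$ of every nonzero codeword $c\in\mathrm{im}\,G_X=\{G_Xu:u\in\mathbb{F}_2^k\}\subseteq\mathbb{F}_2^{X(0)}$ satisfies $$\frac12-\frac{\lambda}{2(1-\lambda)}\leq\frac{|c|}{|X(0)|}\leq\frac12+\frac{\lambda}{2(1-\lambda)}.$$
   Context: An $\mathbb{F}_2$-Grassmannian complex $X$ in ambient space $\mathbb{F}_2^k$ is a collection of linear subspaces of $\mathbb{F}_2^k$ closed under taking subspaces, ordered by inclusion, with $\mathrm{rank}(x)=\dim(x)-1$. $X(i)$ is the set of rank-$i$ elements, the rank of $X$ is the maximum rank $r$ of an element, and every element is assumed to lie in a rank-$r$ element. $X$ carries a standard weight function $m_X:X\to[0,1]$: each restriction to $X(i)$ is a probability distribution, and for $i<r$, $m_X(x_i)=\sum_{x_{i+1}\in X(i+1),\,x_{i+1}\supset x_i}m_X(x_{i+1})/\#\{x_i'\in X(i):x_i'\subset x_{i+1}\}$. A vertex $\{0,v\}\in X(0)$ is identified with the nonzero vector $v\in\mathbb{F}_2^k$. The 1-skeleton graph $\mathbf G_X$ has vertex set $X(0)$, an edge $\{x_0,x_0'\}$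 for distinct $x_0,x_0'$ lying in a common $x_1\in X(1)$, and edge weight $\sum_{x_1\in X(1):x_0,x_0'\in x_1}m_X(x_1)$. For a weighted graph, $\lambda(\mathbf G)$ is the second largest absolute value of an eigenvalue (with multiplicity) of its random walk matrix $\mathbf W_{v,v'}=m(v,v')/\deg(v)$. $\lambda^{(-1)}(X)=\lambda(\mathbf G_X)$. *)

theory Defs
  imports
    "HOL-Analysis.Analysis"
    "HOL-Library.Z2"
    "Jordan_Normal_Form.Char_Poly"
begin

instance bit :: finite
proof
  have "(UNIV :: bit set) = {0, 1}"
    by (auto intro: bit.exhaust)
  then show "finite (UNIV :: bit set)"
    by (metis finite.emptyI finite_insert)
qed


section \<open>Grassmannian complexes over the field with two elements\<close>

text \<open>
  Linear algebra in the ambient space \<^typ>\<open>bit ^ 'k\<close> is that of the library interpretation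
  \<open>vec\<close> (scalars in \<^typ>\<open>bit\<close>). Ranks are integers because the zero subspace, which lies in
  every complex, has rank \<open>-1\<close>.
\<close>

definition rk :: "(bit ^ 'k) set \<Rightarrow> int" where
  "rk x = int (vec.dim x) - 1"

definition level :: "(bit ^ 'k) set set \<Rightarrow> int \<Rightarrow> (bit ^ 'k) set set" where
  "level X i = {x \<in> X. rk x = i}"

definition complex_rank :: "(bit ^ 'k) set set \<Rightarrow> int" where
  "complex_rank X = Max (rk ` X)"

definition grassmannian_complex :: "(bit ^ 'k) set set \<Rightarrow> bool" where
  "grassmannian_complex X \<longleftrightarrow>
     X \<noteq> {} \<and>
     (\<forall>x\<in>X. vec.subspace x) \<and>
     (\<forall>x\<in>X. \<forall>y. vec.subspace y \<and> y \<subseteq> x \<longrightarrow> y \<in> X) \<and>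
     (\<forall>x\<in>X. \<exists>y\<in>level X (complex_rank X). x \<subseteq> y)"

definition standard_weight :: "(bit ^ 'k) set set \<Rightarrow> ((bit ^ 'k) set \<Rightarrow> real) \<Rightarrow> bool" where
  "standard_weight X m \<longleftrightarrow>
     (\<forall>x\<in>X. 0 \<le> m x \<and> m x \<le> 1) \<and>
     (\<forall>i\<in>{-1..complex_rank X}. (\<Sum>x\<in>level X i. m x) = 1) \<and>
     (\<forall>i<complex_rank X. \<forall>x\<in>level X i.
        m x = (\<Sum>y\<in>{y \<in> level X (i + 1). x \<subset> y}. m y / real (card {x' \<in> level X i. x' \<subset> y})))"

text \<open>A vertex is a one-dimensional subspace \<open>{0, v}\<close>; it is identified with \<open>v\<close>.\<close>

definition vertex_vector :: "(bit ^ 'k) set \<Rightarrow> bit ^ 'k" where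
  "vertex_vector x = (THE v. v \<noteq> 0 \<and> x = {0, v})"


section \<open>Weighted graphs and their second eigenvalue\<close>

text \<open>
  A weighted graph is given by its finite vertex set, its set of edges (two-element sets of
  vertices) and a weight for each edge. The degree of a vertex is its weighted degree.
\<close>

definition weighted_degree :: "'a set set \<Rightarrow> ('a set \<Rightarrow> real) \<Rightarrow> 'a \<Rightarrow> real" where
  "weighted_degree E w v = (\<Sum>e\<in>{e \<in> E. v \<in> e}. w e)"

definition walk_entry :: "'a set set \<Rightarrow> ('a set \<Rightarrow> real) \<Rightarrow> 'a \<Rightarrow> 'a \<Rightarrow> real" where
  "walk_entry E w v v' = (if {v, v'} \<in> E then w {v, v'} / weighted_degree E w v else 0)"

text \<open>
  Matrices are indexed by natural numbers, so the vertices are enumerated in an arbitrary order.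
  Another order conjugates the matrix by a permutation matrix and leaves its characteristic
  polynomial unchanged.
\<close>

definition vertex_enum :: "'a set \<Rightarrow> 'a list" where
  "vertex_enum V = (SOME vs. set vs = V \<and> distinct vs)"

definition walk_matrix :: "'a set \<Rightarrow> 'a set set \<Rightarrow> ('a set \<Rightarrow> real) \<Rightarrow> complex mat" where
  "walk_matrix V E w =
     mat (card V) (card V)
       (\<lambda>(i, j). complex_of_real (walk_entry E w (vertex_enum V ! i) (vertex_enum V ! j)))"

definition eigenvalues_mset :: "complex mat \<Rightarrow> complex multiset" where
  "eigenvalues_mset A = proots (char_poly A)"

text \<open>
  The second entry (index 1) of the decreasing list of absolute values of the eigenvalues, each
  repeated according to its multiplicity; meaningful for graphs with at least two vertices.
\<close>

definition second_eigenvalue :: "'a set \<Rightarrow> 'a set set \<Rightarrow> ('a set \<Rightarrow> real) \<Rightarrow> real" where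
  "second_eigenvalue V E w =
     rev (sorted_list_of_multiset (image_mset cmod (eigenvalues_mset (walk_matrix V E w)))) ! 1"

definition skeleton_edges :: "(bit ^ 'k) set set \<Rightarrow> (bit ^ 'k) set set set" where
  "skeleton_edges X =
     {{x, x'} | x x'. x \<in> level X 0 \<and> x' \<in> level X 0 \<and> x \<noteq> x' \<and>
                      (\<exists>y\<in>level X 1. x \<subseteq> y \<and> x' \<subseteq> y)}"

definition skeleton_weight ::
    "(bit ^ 'k) set set \<Rightarrow> ((bit ^ 'k) set \<Rightarrow> real) \<Rightarrow> (bit ^ 'k) set set \<Rightarrow> real" where
  "skeleton_weight X m e = (\<Sum>y\<in>{y \<in> level X 1. \<forall>x\<in>e. x \<subseteq> y}. m y)"

definition skeleton_expansion ::
    "(bit ^ 'k) set set \<Rightarrow> ((bit ^ 'k) set \<Rightarrow> real) \<Rightarrow> real" where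
  "skeleton_expansion X m = second_eigenvalue (level X 0) (skeleton_edges X) (skeleton_weight X m)"


section \<open>The code of a complex\<close>

definition generator_matrix :: "(bit ^ 'k) set \<Rightarrow> 'k \<Rightarrow> bit" where
  "generator_matrix x i = vec_nth (vertex_vector x) i"

text \<open>Words indexed by the vertices are functions that vanish off the vertex set.\<close>

definition encode :: "(bit ^ 'k) set set \<Rightarrow> bit ^ 'k \<Rightarrow> (bit ^ 'k) set \<Rightarrow> bit" where
  "encode X u = (\<lambda>x. if x \<in> level X 0
                     then (\<Sum>i\<in>UNIV. generator_matrix x i * vec_nth u i) else 0)"

definition code :: "(bit ^ 'k) set set \<Rightarrow> ((bit ^ 'k) set \<Rightarrow> bit) set" where
  "code X = range (encode X)"

definition hamming_weight :: "('a \<Rightarrow> bit) \<Rightarrow> nat" where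
  "hamming_weight c = card {x. c x \<noteq> 0}"

end

theory Submission
  imports Defs
begin

text \<open>
  Let \<open>A\<close> be the support of a codeword, a fraction \<open>\<alpha> > 0\<close> of the \<open>n\<close> vertices. The three
  vertices of a plane are \<open>a\<close>, \<open>b\<close> and \<open>a + b\<close>, so a plane that meets \<open>A\<close> meets it in exactly two
  vertices: a step of the random walk from a vertex of \<open>A\<close> stays in \<open>A\<close> with probability \<open>1/2\<close>.
  Since the vertex weights agree, the walk matrix \<open>W\<close> is symmetric, and for \<open>f = 1\<^sub>A - \<alpha>\<close> one gets
  \<open>\<langle>f, W f\<rangle> = \<alpha> (1/2 - \<alpha>) n\<close> and \<open>\<langle>f, f\<rangle> = \<alpha> (1 - \<alpha>) n\<close>. As \<open>f\<close> is orthogonal to the constants,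
  \<open>\<bar>1/2 - \<alpha>\<bar> \<le> \<lambda> (1 - \<alpha>)\<close>, from which both bounds follow.
\<close>

section \<open>Eigenvalues\<close>

no_notation scalar_prod (infix "\<bullet>" 70)

text \<open>At least two entries of the decreasing list are \<open>\<ge> t\<close>. Were the entry
  at index 1 below \<open>t\<close>, so would be all later ones, leaving only the head.\<close>

lemma second_largest_ge:
  fixes M :: "'a::linorder multiset"
  assumes "{#a, b#} \<subseteq># M" "t \<le> a" "t \<le> b"
  shows "t \<le> rev (sorted_list_of_multiset M) ! 1"
proof -
  let ?R = "rev (sorted_list_of_multiset M)"
  have mR: "mset ?R = M" by simp
  have srt: "sorted_wrt (\<ge>) ?R"
    using sorted_sorted_list_of_multiset[of M] by (simp add: sorted_wrt_rev)
  have "size (filter_mset (\<lambda>x. t \<le> x) {#a, b#}) \<le> size (filter_mset (\<lambda>x. t \<le> x) (mset ?R))"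
    by (intro size_mset_mono multiset_filter_mono) (use assms mR in simp)
  then have two: "2 \<le> length (filter (\<lambda>x. t \<le> x) ?R)"
    unfolding mset_filter[symmetric] size_mset using assms(2,3) by simp
  show ?thesis
  \<comment> \<open>This rule serves only to separate empty, one-element and longer lists.\<close>
  proof (cases ?R rule: remdups_adj.cases)
    case 1 with two show ?thesis by simp
  next
    case (2 x) with two show ?thesis by (simp split: if_splits)
  next
    case (3 x y zs)
    show ?thesis
    proof (rule ccontr)
      assume "\<not> ?thesis"
      then have "y < t" using 3 by simp
      moreover have "\<forall>z\<in>set zs. z \<le> y" using srt unfolding 3 by simp
      ultimately have "filter (\<lambda>x. t \<le> x) (y # zs) = []" by (auto simp: filter_empty_conv)
      then show False using two unfolding 3 by (simp split: if_splits)
    qed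
  qed
qed

text \<open>Since \<open>z\<close> vanishes at \<open>i\<close>, dropping that coordinate keeps it
  nonzero, and the deleted column contributed 0 to every product. What remains is an eigenvector of
  the principal minor.\<close>

lemma root_char_poly_mat_delete:
  fixes A :: "'a::field mat"
  assumes A: "A \<in> carrier_mat n n" and i: "i < n"
    and z: "z \<in> carrier_vec n" "z \<noteq> 0\<^sub>v n" "A *\<^sub>v z = e \<cdot>\<^sub>v z" "vec_index z i = 0"
  shows "poly (char_poly (mat_delete A i i)) e = 0"
proof -
  obtain k where n: "n = Suc k" using i by (cases n) auto
  let ?B = "mat_delete A i i"
  have B: "?B \<in> carrier_mat k k" using mat_delete_carrier[OF A] n by simp
  define z' where "z' = Matrix.vec k (\<lambda>j. vec_index z (insert_index i j))"
  have im: "insert_index i ` {0..<k} = {0..<n} - {i}" using insert_index_image[of i k] i n by simp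
  have "z' \<noteq> 0\<^sub>v k"
  proof
    assume 0: "z' = 0\<^sub>v k"
    have "vec_index z l = 0" if "l < n" for l
    proof (cases "l = i")
      case False
      then have "l \<in> insert_index i ` {0..<k}" using that im by auto
      then obtain j where j: "j < k" "l = insert_index i j" by auto
      have "vec_index z' j = 0" using 0 j by simp
      then show ?thesis using j by (simp add: z'_def)
    qed (use z in simp)
    then have "z = 0\<^sub>v n" using z(1) by (intro eq_vecI) auto
    then show False using z(2) by simp
  qed
  moreover have "?B *\<^sub>v z' = e \<cdot>\<^sub>v z'"
  proof (intro eq_vecI)
    fix r assume "r < dim_vec (e \<cdot>\<^sub>v z')"
    then have r: "r < k" by (simp add: z'_def)
    let ?r = "insert_index i r"
    have rn: "?r < n" "?r \<noteq> i" using imageI[of r "{0..<k}" "insert_index i"] r unfolding im by auto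
    have "vec_index (?B *\<^sub>v z') r = (\<Sum>j\<in>{0..<k}. A $$ (?r, insert_index i j) * vec_index z (insert_index i j))"
      using B r A i n by (auto simp: scalar_prod_def z'_def mat_delete_index intro!: sum.cong)
    also have "\<dots> = (\<Sum>j\<in>insert_index i ` {0..<k}. A $$ (?r, j) * vec_index z j)"
      by (simp add: sum.reindex insert_index_inj_on)
    also have "\<dots> = (\<Sum>j\<in>{0..<n}. A $$ (?r, j) * vec_index z j)"
      unfolding im by (rule sum.mono_neutral_left) (use z in auto)
    also have "\<dots> = vec_index (A *\<^sub>v z) ?r"
      using A z(1) rn by (auto simp: scalar_prod_def)
    also have "\<dots> = vec_index (e \<cdot>\<^sub>v z') r" unfolding z(3) using z(1) rn r by (simp add: z'_def)
    finally show "vec_index (?B *\<^sub>v z') r = vec_index (e \<cdot>\<^sub>v z') r" .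
  qed (use A n in \<open>simp add: z'_def\<close>)
  ultimately have "eigenvalue ?B e"
    unfolding eigenvalue_def eigenvector_def using B by (auto simp: z'_def intro!: exI[of _ z'])
  then show ?thesis using eigenvalue_root_char_poly[OF B] by simp
qed

text \<open>A double eigenvalue is a double root of the characteristic polynomial: the derivative of the
  latter is the sum of those of the principal minors, each of which annihilates a suitable
  combination of the two eigenvectors.\<close>

lemma independent_eigenvectors_subseteq_proots:
  fixes A :: "'a::field_char_0 mat"
  assumes A: "A \<in> carrier_mat n n"
    and v: "v \<in> carrier_vec n" "v \<noteq> 0\<^sub>v n" "A *\<^sub>v v = e \<cdot>\<^sub>v v"
    and w: "w \<in> carrier_vec n" "A *\<^sub>v w = e' \<cdot>\<^sub>v w"
    and ind: "\<And>a. w \<noteq> a \<cdot>\<^sub>v v"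
  shows "{#e, e'#} \<subseteq># proots (char_poly A)"
proof -
  have p0: "char_poly A \<noteq> 0" using degree_monic_char_poly[OF A] by auto
  have "w \<noteq> 0\<^sub>v n" using ind[of 0] v(1) by (auto intro!: eq_vecI)
  then have e: "poly (char_poly A) e = 0" and e': "poly (char_poly A) e' = 0"
    using eigenvalue_root_char_poly[OF A] A v w unfolding eigenvalue_def eigenvector_def by auto
  show ?thesis
  proof (cases "e = e'")
    case False
    then show ?thesis using e e' p0
      by (auto simp: subseteq_mset_def order_gt_0_iff Suc_le_eq)
  next
    case True
    have "poly (pderiv (char_poly A)) e = (\<Sum>i<n. poly (char_poly (mat_delete A i i)) e)"
      by (simp add: pderiv_char_poly[OF A] poly_sum)
    also have "\<dots> = 0"
    proof (intro sum.neutral ballI)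
      fix i assume "i \<in> {..<n}"
      then have i: "i < n" by simp
      have "\<exists>z\<in>carrier_vec n. z \<noteq> 0\<^sub>v n \<and> A *\<^sub>v z = e \<cdot>\<^sub>v z \<and> vec_index z i = 0"
      proof (cases "vec_index v i = 0")
        case True then show ?thesis using v by auto
      next
        case nz: False
        \<comment> \<open>This \<open>q\<close> makes \<open>w - q v\<close> vanish at coordinate
          \<open>i\<close>. The combination is nonzero because \<open>w\<close> is no multiple of
          \<open>v\<close>, and an eigenvector because the two eigenvalues agree.\<close>
        define q where "q = vec_index w i / vec_index v i"
        have "w - q \<cdot>\<^sub>v v \<noteq> 0\<^sub>v n"
        proof
          assume *: "w - q \<cdot>\<^sub>v v = 0\<^sub>v n"
          have "w = q \<cdot>\<^sub>v v"
          proof (intro eq_vecI)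
            fix j assume "j < dim_vec (q \<cdot>\<^sub>v v)"
            then have "j < n" using v by simp
            then have "vec_index (w - q \<cdot>\<^sub>v v) j = 0" using * by simp
            then show "vec_index w j = vec_index (q \<cdot>\<^sub>v v) j" using \<open>j < n\<close> v w by simp
          qed (use v w in simp)
          then show False using ind by blast
        qed
        moreover have "A *\<^sub>v (w - q \<cdot>\<^sub>v v) = e \<cdot>\<^sub>v (w - q \<cdot>\<^sub>v v)"
        proof -
          have "A *\<^sub>v (w - q \<cdot>\<^sub>v v) = A *\<^sub>v w - q \<cdot>\<^sub>v (A *\<^sub>v v)"
            using A v w by (simp add: mult_minus_distrib_mat_vec mult_mat_vec)
          also have "\<dots> = e \<cdot>\<^sub>v (w - q \<cdot>\<^sub>v v)"
            unfolding v(3) w(2) using v(1) w(1) True by (intro eq_vecI) (auto simp: algebra_simps)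
          finally show ?thesis .
        qed
        ultimately show ?thesis using v w i nz
          by (intro bexI[of _ "w - q \<cdot>\<^sub>v v"]) (auto simp: q_def)
      qed
      then show "poly (char_poly (mat_delete A i i)) e = 0"
        using root_char_poly_mat_delete[OF A i] by blast
    qed
    finally have pd: "poly (pderiv (char_poly A)) e = 0" .
    \<comment> \<open>A root bounds the order from below only for a nonzero polynomial.
      Characteristic 0 enters here: a zero derivative would force a constant polynomial, and one
      with root \<open>e\<close> is zero.\<close>
    have "pderiv (char_poly A) \<noteq> 0"
    proof
      assume "pderiv (char_poly A) = 0"
      then have "degree (char_poly A) = 0" by (simp add: pderiv_eq_0_iff)
      then show False using e p0 by (metis degree_0_id poly_const_conv pCons_0_0)
    qed
    then have "order e (char_poly A) \<ge> 2"
      using pd order_pderiv[OF p0 e] order_root[of "pderiv (char_poly A)" e] by simp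
    then show ?thesis using True p0 by (auto simp: subseteq_mset_def)
  qed
qed

text \<open>The quadratic form attains its maximum \<open>\<theta>\<close> on the unit sphere of
  \<open>S\<close> by compactness. First-order optimality in the direction of the residual
  \<open>\<theta> z - L z\<close>, which lies in \<open>S\<close> by invariance, forces the residual
  to vanish.\<close>

lemma self_adjoint_max_eigenvector:
  fixes L :: "'a::euclidean_space \<Rightarrow> 'a"
  assumes L: "linear L" and adj: "\<And>x y. L x \<bullet> y = x \<bullet> L y"
    and S: "subspace S" "\<And>x. x \<in> S \<Longrightarrow> L x \<in> S" and f: "f \<in> S" "f \<noteq> 0"
  obtains z \<theta> where "z \<in> S" "z \<noteq> 0" "L z = \<theta> *\<^sub>R z" "\<And>x. x \<in> S \<Longrightarrow> x \<bullet> L x \<le> \<theta> * (x \<bullet> x)"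
proof -
  have bl: "bounded_linear L" using L linear_conv_bounded_linear by blast
  let ?K = "S \<inter> sphere 0 1"
  have "compact ?K" by (simp add: closed_subspace S(1) closed_Int_compact)
  moreover have nf: "x /\<^sub>R norm x \<in> ?K" if "x \<in> S" "x \<noteq> 0" for x
    using that S(1) by (auto simp: subspace_mul)
  then have "?K \<noteq> {}" using f by blast
  moreover have "continuous_on ?K (\<lambda>x. x \<bullet> L x)"
    by (intro continuous_intros linear_continuous_on bl)
  ultimately obtain z where z: "z \<in> ?K" and mx: "\<And>x. x \<in> ?K \<Longrightarrow> x \<bullet> L x \<le> z \<bullet> L z"
    using continuous_attains_sup by metis
  define \<theta> where "\<theta> = z \<bullet> L z"
  have z1: "z \<bullet> z = 1" using z by (simp add: dot_square_norm)
  have le: "x \<bullet> L x \<le> \<theta> * (x \<bullet> x)" if "x \<in> S" for x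
  proof (cases "x = 0")
    case True then show ?thesis by simp
  next
    case False
    have "(x /\<^sub>R norm x) \<bullet> L (x /\<^sub>R norm x) \<le> \<theta>" using mx[OF nf[OF that False]] by (simp add: \<theta>_def)
    then have "(x \<bullet> L x) / (norm x)\<^sup>2 \<le> \<theta>"
      using L by (simp add: linear_cmul power2_eq_square field_simps)
    then show ?thesis using False by (simp add: field_simps power2_norm_eq_inner)
  qed
  define h where "h = \<theta> *\<^sub>R z - L z"
  have hS: "h \<in> S" using z S unfolding h_def by (auto intro!: subspace_diff subspace_mul)
  \<comment> \<open>The Rayleigh bound at \<open>z + t h\<close>, expanded in \<open>t\<close>: the
    constant term is 0 because \<open>z\<close> is a maximiser, and the linear coefficient is twice
    the squared norm of \<open>h\<close>.\<close>
  have quad: "0 \<le> 2 * t * (h \<bullet> h) + t\<^sup>2 * (\<theta> * (h \<bullet> h) - h \<bullet> L h)" for t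
  proof -
    have "z + t *\<^sub>R h \<in> S" using z hS S(1) by (auto intro!: subspace_add subspace_mul)
    then have "0 \<le> \<theta> * ((z + t *\<^sub>R h) \<bullet> (z + t *\<^sub>R h)) - (z + t *\<^sub>R h) \<bullet> L (z + t *\<^sub>R h)"
      using le by force
    also have "\<dots> = \<theta> * (z \<bullet> z) - z \<bullet> L z + 2 * t * (\<theta> * (z \<bullet> h) - L z \<bullet> h)
       + t\<^sup>2 * (\<theta> * (h \<bullet> h) - h \<bullet> L h)"
      using adj[of z h] inner_commute[of h z] inner_commute[of h "L z"]
      by (simp add: linear_add[OF L] linear_cmul[OF L] inner_add_left inner_add_right
          power2_eq_square algebra_simps)
    also have "\<theta> * (z \<bullet> h) - L z \<bullet> h = h \<bullet> h"
      by (simp add: h_def inner_diff_left)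
    also have "\<theta> * (z \<bullet> z) - z \<bullet> L z = 0" using z1 by (simp add: \<theta>_def)
    finally show ?thesis by simp
  qed
  have "h \<bullet> h = 0"
  proof (rule ccontr)
    assume "h \<bullet> h \<noteq> 0"
    then have p: "h \<bullet> h > 0" by simp
    define q where "q = \<theta> * (h \<bullet> h) - h \<bullet> L h"
    have q: "q \<ge> 0" using le[OF hS] by (simp add: q_def)
    \<comment> \<open>A small negative \<open>t\<close> lets the linear term win and makes the
      polynomial negative. The \<open>+ 1\<close> keeps the denominator positive when
      \<open>q = 0\<close>.\<close>
    define t where "t = - (h \<bullet> h) / (q + 1)"
    have "2 * t * (h \<bullet> h) + t\<^sup>2 * q = (h \<bullet> h)\<^sup>2 / (q + 1) * (q / (q + 1) - 2)"
      using q by (simp add: t_def power2_eq_square divide_simps) (simp add: algebra_simps)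
    also have "\<dots> < 0"
      using p q by (intro mult_pos_neg) (auto simp: divide_simps)
    finally show False using quad[of t] by (simp add: q_def)
  qed
  then have "L z = \<theta> *\<^sub>R z" by (simp add: h_def)
  moreover have "z \<in> S" "z \<noteq> 0" using z by auto
  ultimately show thesis using that le by blast
qed

section \<open>Random walks with symmetric matrix\<close>

lemma vertex_enum_properties:
  assumes "finite V"
  shows "set (vertex_enum V) = V" "distinct (vertex_enum V)" "length (vertex_enum V) = card V"
proof -
  have "set (vertex_enum V) = V \<and> distinct (vertex_enum V)"
    unfolding vertex_enum_def by (rule someI_ex) (use finite_distinct_list[OF assms] in blast)
  then show "set (vertex_enum V) = V" "distinct (vertex_enum V)" "length (vertex_enum V) = card V"
    using distinct_card by fastforce+
qed

lemma sum_vertex_enum: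
  assumes "finite V"
  shows "(\<Sum>j\<in>{0..<card V}. g (vertex_enum V ! j)) = (\<Sum>x\<in>V. g x)"
  using sum.reindex_bij_betw[OF bij_betw_nth[OF vertex_enum_properties(2)[OF assms] refl refl], of g]
  by (simp add: vertex_enum_properties[OF assms] atLeast0LessThan)

lemma walk_matrix_mult_vec:
  assumes "finite V" and "\<And>x. x \<in> V \<Longrightarrow> (\<Sum>x'\<in>V. walk_entry E w x x' * f x') = \<theta> * f x"
  defines "v \<equiv> Matrix.vec (card V) (\<lambda>i. complex_of_real (f (vertex_enum V ! i)))"
  shows "walk_matrix V E w *\<^sub>v v = complex_of_real \<theta> \<cdot>\<^sub>v v"
proof (intro eq_vecI)
  fix i assume "i < dim_vec (complex_of_real \<theta> \<cdot>\<^sub>v v)"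
  then have i: "i < card V" by (simp add: v_def)
  let ?x = "vertex_enum V ! i"
  have x: "?x \<in> V" using i vertex_enum_properties[OF assms(1)] by (metis nth_mem)
  have "vec_index (walk_matrix V E w *\<^sub>v v) i
      = (\<Sum>j\<in>{0..<card V}. complex_of_real (walk_entry E w ?x (vertex_enum V ! j) * f (vertex_enum V ! j)))"
    using i by (simp add: walk_matrix_def v_def scalar_prod_def)
  also have "\<dots> = complex_of_real (\<theta> * f ?x)"
    using sum_vertex_enum[OF assms(1), of "\<lambda>x'. complex_of_real (walk_entry E w ?x x' * f x')"]
      assms(2)[OF x] by (metis of_real_sum)
  finally show "vec_index (walk_matrix V E w *\<^sub>v v) i = vec_index (complex_of_real \<theta> \<cdot>\<^sub>v v) i"
    using i by (simp add: v_def)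
qed (simp add: walk_matrix_def v_def)

text \<open>The constants are an eigenvector for 1, and a nonzero \<open>f\<close> with sum 0 is not
  a multiple of them. So 1 and \<open>\<theta>\<close> both occur among the eigenvalues, twice if
  they coincide.\<close>

lemma eigenvalue_le_second_eigenvalue:
  assumes V: "finite V" and one: "\<And>x. x \<in> V \<Longrightarrow> (\<Sum>x'\<in>V. walk_entry E w x x') = 1"
    and f: "\<And>x. x \<in> V \<Longrightarrow> (\<Sum>x'\<in>V. walk_entry E w x x' * f x') = \<theta> * f x"
    and sum0: "(\<Sum>x\<in>V. f x) = 0" and nz: "x0 \<in> V" "f x0 \<noteq> 0"
    and lt1: "second_eigenvalue V E w < 1"
  shows "\<bar>\<theta>\<bar> \<le> second_eigenvalue V E w"
proof -
  let ?n = "card V" and ?A = "walk_matrix V E w"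
  let ?v = "\<lambda>f. Matrix.vec ?n (\<lambda>i. complex_of_real (f (vertex_enum V ! i)))"
  have n: "?n > 0" using V nz by (auto simp: card_gt_0_iff)
  have in_V: "vertex_enum V ! i \<in> V" if "i < ?n" for i
    using that vertex_enum_properties[OF V] by (metis nth_mem)
  have "{#complex_of_real 1, complex_of_real \<theta>#} \<subseteq># proots (char_poly ?A)"
  proof (rule independent_eigenvectors_subseteq_proots)
    show "?A \<in> carrier_mat ?n ?n" by (simp add: walk_matrix_def)
    show "?A *\<^sub>v ?v (\<lambda>_. 1) = complex_of_real 1 \<cdot>\<^sub>v ?v (\<lambda>_. 1)"
      by (rule walk_matrix_mult_vec[OF V]) (simp add: one)
    show "?A *\<^sub>v ?v f = complex_of_real \<theta> \<cdot>\<^sub>v ?v f"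
      by (rule walk_matrix_mult_vec[OF V f])
    show "?v (\<lambda>_. 1) \<noteq> 0\<^sub>v ?n"
    proof
      assume "?v (\<lambda>_. 1) = 0\<^sub>v ?n"
      then have "vec_index (?v (\<lambda>_. 1)) 0 = vec_index (0\<^sub>v ?n :: complex Matrix.vec) 0" by simp
      then show False using n by simp
    qed
    show "?v f \<noteq> a \<cdot>\<^sub>v ?v (\<lambda>_. 1)" for a
    proof
      assume eq: "?v f = a \<cdot>\<^sub>v ?v (\<lambda>_. 1)"
      have *: "complex_of_real (f x) = a" if "x \<in> V" for x
      proof -
        have "x \<in> set (vertex_enum V)" using that vertex_enum_properties(1)[OF V] by simp
        then obtain i where i: "i < ?n" "vertex_enum V ! i = x"
          unfolding in_set_conv_nth vertex_enum_properties(3)[OF V] by blast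
        have "vec_index (?v f) i = vec_index (a \<cdot>\<^sub>v ?v (\<lambda>_. 1)) i" using eq by simp
        then show ?thesis using i by simp
      qed
      have "f x = f x0" if "x \<in> V" for x using *[OF that] *[OF nz(1)] of_real_eq_iff by metis
      then have "(\<Sum>x\<in>V. f x) = real ?n * f x0" by simp
      then show False using sum0 nz n by simp
    qed
  qed auto
  then have "image_mset cmod {#complex_of_real 1, complex_of_real \<theta>#} \<subseteq>#
      image_mset cmod (eigenvalues_mset ?A)"
    unfolding eigenvalues_mset_def by (rule image_mset_subseteq_mono)
  then have "{#1, \<bar>\<theta>\<bar>#} \<subseteq># image_mset cmod (eigenvalues_mset ?A)" by simp
  \<comment> \<open>The minimum bounds both absolute values from below; since the second eigenvalue
    is below 1, it must be \<open>\<bar>\<theta>\<bar>\<close>.\<close>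
  then have "min 1 \<bar>\<theta>\<bar> \<le> second_eigenvalue V E w"
    unfolding second_eigenvalue_def by (rule second_largest_ge) auto
  then show ?thesis using lt1 by (simp add: min_le_iff_disj)
qed

text \<open>Symmetry makes the walk self-adjoint on the functions of sum 0. The extreme values of
  its Rayleigh quotient there are eigenvalues, to which the preceding bound applies.\<close>

lemma walk_quadratic_form_le:
  fixes V :: "'a::finite set"
  assumes sym: "\<And>x x'. x \<in> V \<Longrightarrow> x' \<in> V \<Longrightarrow> walk_entry E w x x' = walk_entry E w x' x"
    and one: "\<And>x. x \<in> V \<Longrightarrow> (\<Sum>x'\<in>V. walk_entry E w x x') = 1"
    and lt1: "second_eigenvalue V E w < 1" and sum0: "(\<Sum>x\<in>V. f x) = 0"
  shows "\<bar>\<Sum>x\<in>V. f x * (\<Sum>x'\<in>V. walk_entry E w x x' * f x')\<bar> \<le>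
    second_eigenvalue V E w * (\<Sum>x\<in>V. (f x)\<^sup>2)"
proof -
  \<comment> \<open>Functions on \<open>V\<close> are extended by 0 to the whole finite type, so
    that they live in a euclidean space.\<close>
  define S :: "(real ^ 'a) set"
    where "S = {g. (\<forall>x. x \<notin> V \<longrightarrow> vec_nth g x = 0) \<and> (\<Sum>x\<in>V. vec_nth g x) = 0}"
  define L :: "real ^ 'a \<Rightarrow> real ^ 'a" where
    "L g = (\<chi> x. if x \<in> V then \<Sum>x'\<in>V. walk_entry E w x x' * vec_nth g x' else 0)" for g
  have L: "linear L"
  proof (rule linearI)
    show "L (g + h) = L g + L h" for g h
      by (simp add: L_def Finite_Cartesian_Product.vec_eq_iff sum.distrib distrib_left)
    show "L (a *\<^sub>R g) = a *\<^sub>R L g" for a g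
      by (simp add: L_def Finite_Cartesian_Product.vec_eq_iff sum_distrib_left mult.left_commute)
  qed
  have inner_S: "g \<bullet> h = (\<Sum>x\<in>V. vec_nth g x * vec_nth h x)" if "\<And>x. x \<notin> V \<Longrightarrow> vec_nth h x = 0"
    for g h :: "real ^ 'a"
    unfolding inner_vec_def by (rule sum.mono_neutral_cong_right) (use that in auto)
  have L_form: "g \<bullet> L h = (\<Sum>x\<in>V. vec_nth g x * (\<Sum>x'\<in>V. walk_entry E w x x' * vec_nth h x'))" for g h
    by (subst inner_S) (auto simp: L_def intro!: sum.cong)
  have adj: "L g \<bullet> h = g \<bullet> L h" for g h
  proof -
    have "L g \<bullet> h = (\<Sum>x\<in>V. \<Sum>x'\<in>V. vec_nth h x * (walk_entry E w x x' * vec_nth g x'))"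
      by (simp add: inner_commute[of "L g"] L_form sum_distrib_left)
    also have "\<dots> = (\<Sum>x'\<in>V. \<Sum>x\<in>V. vec_nth h x * (walk_entry E w x x' * vec_nth g x'))"
      by (rule sum.swap)
    also have "\<dots> = g \<bullet> L h"
      unfolding L_form sum_distrib_left by (intro sum.cong refl) (simp add: sym)
    finally show ?thesis .
  qed
  have S: "subspace S"
    by (auto simp: subspace_def S_def sum.distrib simp flip: sum_distrib_left)
  \<comment> \<open>By symmetry the column sums are 1 as well, so the walk preserves the sum of a
    function.\<close>
  have LS: "L g \<in> S" if "g \<in> S" for g
  proof -
    have "(\<Sum>x\<in>V. vec_nth (L g) x) = (\<Sum>x\<in>V. \<Sum>x'\<in>V. walk_entry E w x x' * vec_nth g x')"
      by (simp add: L_def)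
    also have "\<dots> = (\<Sum>x'\<in>V. \<Sum>x\<in>V. walk_entry E w x x' * vec_nth g x')" by (rule sum.swap)
    also have "\<dots> = (\<Sum>x'\<in>V. (\<Sum>x\<in>V. walk_entry E w x' x) * vec_nth g x')"
      unfolding sum_distrib_right by (intro sum.cong refl) (simp add: sym)
    also have "\<dots> = 0" using that by (simp add: one S_def)
    finally show ?thesis by (simp add: S_def L_def)
  qed
  have eig: "\<bar>\<theta>\<bar> \<le> second_eigenvalue V E w" if z: "z \<in> S" "z \<noteq> 0" "L z = \<theta> *\<^sub>R z" for z \<theta>
  proof -
    obtain x0 where x0: "vec_nth z x0 \<noteq> 0" using z(2) by (auto simp: Finite_Cartesian_Product.vec_eq_iff)
    show ?thesis
    proof (rule eigenvalue_le_second_eigenvalue[where f = "vec_nth z"])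
      show "(\<Sum>x'\<in>V. walk_entry E w x x' * vec_nth z x') = \<theta> * vec_nth z x" if "x \<in> V" for x
        using arg_cong[OF z(3), of "\<lambda>g. vec_nth g x"] that by (simp add: L_def)
      show "x0 \<in> V" using z(1) x0 by (auto simp: S_def)
    qed (use z(1) x0 one lt1 in \<open>simp_all add: S_def\<close>)
  qed
  define g :: "real ^ 'a" where "g = (\<chi> x. if x \<in> V then f x else 0)"
  have gS: "g \<in> S" using sum0 by (simp add: S_def g_def)
  have gLg: "g \<bullet> L g = (\<Sum>x\<in>V. f x * (\<Sum>x'\<in>V. walk_entry E w x x' * f x'))"
    unfolding L_form by (simp add: g_def)
  have gg: "g \<bullet> g = (\<Sum>x\<in>V. (f x)\<^sup>2)"
    by (subst inner_S) (auto simp: g_def power2_eq_square)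
  have "\<bar>g \<bullet> L g\<bar> \<le> second_eigenvalue V E w * (g \<bullet> g)"
  proof (cases "g = 0")
    case False
    obtain z \<theta> where z: "z \<in> S" "z \<noteq> 0" "L z = \<theta> *\<^sub>R z" "g \<bullet> L g \<le> \<theta> * (g \<bullet> g)"
      using self_adjoint_max_eigenvector[OF L adj S LS gS False] gS by metis
    \<comment> \<open>The maximum for \<open>- L\<close> is the negated minimum for
      \<open>L\<close>, which gives the other half of the absolute value.\<close>
    obtain z' \<theta>' where z': "z' \<in> S" "z' \<noteq> 0" "- L z' = \<theta>' *\<^sub>R z'" "g \<bullet> - L g \<le> \<theta>' * (g \<bullet> g)"
      by (rule self_adjoint_max_eigenvector[of "\<lambda>g. - L g", OF _ _ S _ gS False])
         (use gS L adj LS S in \<open>auto simp: linear_compose_neg subspace_neg\<close>)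
    have "L z' = (- \<theta>') *\<^sub>R z'" using z'(3) by (metis minus_minus scaleR_minus_left)
    then have "\<theta>' \<le> second_eigenvalue V E w" using eig[OF z'(1,2)] by fastforce
    moreover have "\<theta> \<le> second_eigenvalue V E w" using eig[OF z(1-3)] by simp
    ultimately show ?thesis
      using z(4) z'(4) mult_right_mono[of \<theta> _ "g \<bullet> g"] mult_right_mono[of \<theta>' _ "g \<bullet> g"]
      by (simp add: abs_le_iff) (meson inner_ge_zero order_trans)
  qed simp
  then show ?thesis unfolding gLg gg .
qed

section \<open>Vertices and planes\<close>

lemma bit_vec_scale: "k *s (v :: bit ^ 'k) = (if k = 0 then 0 else v)"
  by (cases k) auto

lemma bit_vec_add_self [simp]: "v + v = (0 :: bit ^ 'k)"
proof -
  have "vec_nth (v + v) i = vec_nth 0 i" for i by (cases "vec_nth v i") simp_all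
  then show ?thesis unfolding Finite_Cartesian_Product.vec_eq_iff by blast
qed

lemma bit_vec_add_eq_0: "a + b = 0 \<longleftrightarrow> a = (b :: bit ^ 'k)"
  by (metis add_left_cancel bit_vec_add_self)

lemma span_bit_singleton: "vec.span {v} = {0, v :: bit ^ 'k}"
proof -
  have "range (\<lambda>k. k *s v) = {0, v}"
    by (auto simp: bit_vec_scale image_iff split: if_splits intro: exI[of _ 1] exI[of _ 0])
  then show ?thesis by (simp add: vec.span_singleton)
qed

lemma span_bit_pair: "vec.span {a, b} = {0, a, b, a + (b :: bit ^ 'k)}" (is "?L = ?R")
proof
  show "?L \<subseteq> ?R"
  proof
    fix x assume "x \<in> ?L"
    then obtain k where "x - k *s a = 0 \<or> x - k *s a = b"
      by (auto simp: vec.span_breakdown_eq[of x a] span_bit_singleton)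
    then have "x = k *s a \<or> x = k *s a + b" by (auto simp: diff_eq_eq add.commute)
    then show "x \<in> ?R" by (auto simp: bit_vec_scale)
  qed
  show "?R \<subseteq> ?L"
    by (auto intro: vec.span_base vec.span_add vec.span_zero)
qed

lemma bit_subspace_dim_1:
  "vec.subspace x \<and> vec.dim x = 1 \<longleftrightarrow> (\<exists>v. v \<noteq> 0 \<and> x = {0, v :: bit ^ 'k})"
proof safe
  assume x: "vec.subspace x" "vec.dim x = 1"
  obtain B where B: "vec.independent B" "vec.span B = x" "card B = 1"
    using vec.basis_subspace_exists[OF x(1)] x(2) by metis
  then obtain v where "B = {v}" by (meson card_1_singletonE)
  then show "\<exists>v. v \<noteq> 0 \<and> x = {0, v}"
    using B by (intro exI[of _ v]) (auto simp: span_bit_singleton)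
next
  fix v :: "bit ^ 'k" assume v: "v \<noteq> 0"
  show "vec.subspace {0, v}" using vec.subspace_span[of "{v}"] by (simp add: span_bit_singleton)
  show "vec.dim {0, v} = 1" using v vec.dim_span[of "{v}"] by (simp add: span_bit_singleton)
qed

lemma bit_subspace_dim_2:
  assumes "vec.subspace y" "vec.dim y = 2"
  obtains a b :: "bit ^ 'k" where "a \<noteq> 0" "b \<noteq> 0" "a \<noteq> b" "y = {0, a, b, a + b}"
proof -
  obtain B where B: "vec.independent B" "vec.span B = y" "card B = 2"
    using vec.basis_subspace_exists[OF assms(1)] assms(2) by metis
  then obtain a b where "B = {a, b}" "a \<noteq> b" by (meson card_2_iff)
  then show thesis using B vec.dependent_zero[of B] by (intro that[of a b]) (auto simp: span_bit_pair)
qed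

lemma level_0_iff:
  assumes "grassmannian_complex X"
  shows "x \<in> level X 0 \<longleftrightarrow> x \<in> X \<and> (\<exists>v. v \<noteq> 0 \<and> x = {0, v})"
  using assms bit_subspace_dim_1[of x]
  by (auto simp: level_def rk_def grassmannian_complex_def)

lemma vertex_vector_pair: "v \<noteq> 0 \<Longrightarrow> vertex_vector {0, v} = v"
  unfolding vertex_vector_def by (rule the_equality) (auto simp: doubleton_eq_iff)

lemma plane_vertices:
  assumes X: "grassmannian_complex X" and y: "y \<in> level X 1"
  obtains a b where "a \<noteq> 0" "b \<noteq> 0" "a \<noteq> b"
    "{x \<in> level X 0. x \<subseteq> y} = {{0, a}, {0, b}, {0, a + b}}"
proof -
  have "vec.subspace y" "vec.dim y = 2" "y \<in> X"
    using X y by (auto simp: level_def rk_def grassmannian_complex_def)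
  then obtain a b where ab: "a \<noteq> 0" "b \<noteq> 0" "a \<noteq> b" "y = {0, a, b, a + b}"
    using bit_subspace_dim_2 by metis
  have "{0, v} \<in> X" if "v \<in> y" "v \<noteq> 0" for v
  proof -
    have "vec.subspace {0, v}" using that bit_subspace_dim_1 by blast
    moreover have "{0, v} \<subseteq> y" using that ab by auto
    ultimately show ?thesis using X \<open>y \<in> X\<close> unfolding grassmannian_complex_def by blast
  qed
  then have "{x \<in> level X 0. x \<subseteq> y} = (\<lambda>v. {0, v}) ` (y - {0})"
    using ab by (auto simp: level_0_iff[OF X])
  also have "y - {0} = {a, b, a + b}" using ab by (auto simp: bit_vec_add_eq_0)
  finally show thesis using ab that by simp
qed

lemma card_plane_vertices:
  assumes X: "grassmannian_complex X" and y: "y \<in> level X 1"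
  shows "card {x \<in> level X 0. x \<subseteq> y} = 3"
proof -
  obtain a b where "a \<noteq> 0" "b \<noteq> 0" "a \<noteq> b"
    "{x \<in> level X 0. x \<subseteq> y} = {{0, a}, {0, b}, {0, a + b}}"
    using plane_vertices[OF assms] .
  then show ?thesis by (simp add: doubleton_eq_iff)
qed

lemma level_strict_subset_iff:
  assumes "x \<in> level X i" "y \<in> level X j" "i \<noteq> j"
  shows "x \<subset> y \<longleftrightarrow> x \<subseteq> y"
  using assms by (auto simp: level_def)

text \<open>A codeword is linear in the vertex vector, so its values at \<open>a\<close>,
  \<open>b\<close> and \<open>a + b\<close> sum to 0. If one of them is 1, exactly one of the other
  two is.\<close>

lemma codeword_on_plane:
  assumes X: "grassmannian_complex X" and c: "c \<in> code X" and y: "y \<in> level X 1"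
    and x: "x \<in> level X 0" "x \<subseteq> y" "c x \<noteq> 0"
  shows "(\<Sum>x'\<in>{x' \<in> level X 0. x' \<subseteq> y} - {x}. if c x' = 0 then 0 else 1) = (1::real)"
proof -
  obtain a b where ab: "a \<noteq> 0" "b \<noteq> 0" "a \<noteq> b"
    and P: "{x \<in> level X 0. x \<subseteq> y} = {{0, a}, {0, b}, {0, a + b}}"
    using plane_vertices[OF X y] .
  obtain u where u: "c = encode X u" using c by (auto simp: code_def)
  define l where "l v = (\<Sum>i\<in>UNIV. vec_nth v i * vec_nth u i)" for v
  have cl: "c {0, v} = l v" if "{0, v} \<in> level X 0" "v \<noteq> 0" for v
    using that by (simp add: u encode_def generator_matrix_def vertex_vector_pair l_def)
  have V: "{0, a} \<in> level X 0" "{0, b} \<in> level X 0" "{0, a + b} \<in> level X 0"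
    using P by blast+
  have ab0: "a + b \<noteq> 0" using ab by (simp add: bit_vec_add_eq_0)
  have "l (a + b) = l a + l b" by (simp only: l_def vector_add_component distrib_right sum.distrib)
  then have cadd: "c {0, a + b} = c {0, a} + c {0, b}"
    using cl V ab ab0 by simp
  define p q r where "p = {0, a}" and "q = {0, b}" and "r = {0, a + b}"
  have distinct: "p \<noteq> q" "p \<noteq> r" "q \<noteq> r"
    using ab ab0 by (auto simp: p_def q_def r_def doubleton_eq_iff)
  have P: "{x \<in> level X 0. x \<subseteq> y} = {p, q, r}" and cr: "c r = c p + c q"
    using P cadd by (simp_all add: p_def q_def r_def)
  have "x = p \<or> x = q \<or> x = r" using x P by blast
  then show ?thesis unfolding P
  proof (elim disjE)
    assume "x = p"
    then have "{p, q, r} - {x} = {q, r}" using distinct by auto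
    then show "(\<Sum>x'\<in>{p, q, r} - {x}. if c x' = 0 then 0 else 1) = (1::real)"
      using distinct cr x(3) \<open>x = p\<close> by (cases "c q") simp_all
  next
    assume "x = q"
    then have "{p, q, r} - {x} = {p, r}" using distinct by auto
    then show "(\<Sum>x'\<in>{p, q, r} - {x}. if c x' = 0 then 0 else 1) = (1::real)"
      using distinct cr x(3) \<open>x = q\<close> by (cases "c p") simp_all
  next
    assume "x = r"
    then have "{p, q, r} - {x} = {p, q}" using distinct by auto
    then show "(\<Sum>x'\<in>{p, q, r} - {x}. if c x' = 0 then 0 else 1) = (1::real)"
      using distinct cr x(3) \<open>x = r\<close> by (cases "c p"; cases "c q") simp_all
  qed
qed

section \<open>Weights and degrees in the 1-skeleton\<close>

definition joint_weight :: "(bit ^ 'k) set set \<Rightarrow> ((bit ^ 'k) set \<Rightarrow> real) \<Rightarrow>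
    (bit ^ 'k) set \<Rightarrow> (bit ^ 'k) set \<Rightarrow> real" where
  "joint_weight X m x x' = (if x = x' then 0 else skeleton_weight X m {x, x'})"

lemma joint_weight_commute: "joint_weight X m x x' = joint_weight X m x' x"
  by (simp add: joint_weight_def insert_commute)

lemma joint_weight_non_edge:
  assumes "x \<in> level X 0" "x' \<in> level X 0" "{x, x'} \<notin> skeleton_edges X"
  shows "joint_weight X m x x' = 0"
proof (cases "x = x'")
  case False
  then have "{y \<in> level X 1. \<forall>z\<in>{x, x'}. z \<subseteq> y} = {}"
    using assms unfolding skeleton_edges_def by blast
  then show ?thesis unfolding joint_weight_def skeleton_weight_def by (simp only: sum.empty if_cancel)
qed (simp add: joint_weight_def)

lemma skeleton_edge_distinct: "{x, x'} \<in> skeleton_edges X \<Longrightarrow> x \<noteq> x'"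
  by (auto simp: skeleton_edges_def doubleton_eq_iff)

text \<open>The zero diagonal of \<open>joint_weight\<close> matters here: the graph has no loops,
  whereas \<open>skeleton_weight\<close> of a singleton is the weight of all planes through that
  vertex.\<close>

lemma walk_entry_skeleton:
  assumes "x \<in> level X 0" "x' \<in> level X 0"
  shows "walk_entry (skeleton_edges X) (skeleton_weight X m) x x' =
    joint_weight X m x x' / weighted_degree (skeleton_edges X) (skeleton_weight X m) x"
  using joint_weight_non_edge[OF assms, of m] skeleton_edge_distinct[of x x' X]
  by (auto simp: walk_entry_def joint_weight_def)

text \<open>An edge at \<open>x\<close> is determined by its other end; all remaining vertices,
  including \<open>x\<close>, have joint weight 0.\<close>

lemma weighted_degree_skeleton:
  assumes "x \<in> level X 0"
  shows "weighted_degree (skeleton_edges X) (skeleton_weight X m) x =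
    (\<Sum>x'\<in>level X 0. joint_weight X m x x')"
proof -
  let ?N = "{x' \<in> level X 0. {x, x'} \<in> skeleton_edges X}"
  have "\<exists>x'\<in>?N. e = {x, x'}" if e: "e \<in> skeleton_edges X" "x \<in> e" for e
  proof -
    obtain a b where ab: "e = {a, b}" "a \<in> level X 0" "b \<in> level X 0"
      using e(1) unfolding skeleton_edges_def by blast
    consider "x = a" | "x = b" using e(2) ab(1) by blast
    then show ?thesis
    proof cases
      case 1
      then show ?thesis using ab e(1) by blast
    next
      case 2
      then have "e = {x, a}" using ab(1) by (simp add: insert_commute)
      then show ?thesis using ab(2) e(1) by blast
    qed
  qed
  then have "{e \<in> skeleton_edges X. x \<in> e} = (\<lambda>x'. {x, x'}) ` ?N" by blast
  moreover have "inj_on (\<lambda>x'. {x, x'}) ?N" by (auto simp: inj_on_def doubleton_eq_iff)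
  ultimately have "weighted_degree (skeleton_edges X) (skeleton_weight X m) x
      = (\<Sum>x'\<in>?N. skeleton_weight X m {x, x'})"
    unfolding weighted_degree_def by (simp only: sum.reindex o_def)
  also have "\<dots> = (\<Sum>x'\<in>?N. joint_weight X m x x')"
    using skeleton_edge_distinct by (intro sum.cong) (auto simp: joint_weight_def)
  also have "\<dots> = (\<Sum>x'\<in>level X 0. joint_weight X m x x')"
    using joint_weight_non_edge[OF assms] by (intro sum.mono_neutral_left) auto
  finally show ?thesis .
qed

text \<open>Double counting of pairs of a plane through \<open>x\<close> and a further vertex
  \<open>x'\<close> in it.\<close>

lemma sum_joint_weight:
  "(\<Sum>x'\<in>level X 0. joint_weight X m x x' * g x') =
    (\<Sum>y\<in>{y \<in> level X 1. x \<subseteq> y}. m y * (\<Sum>x'\<in>{x' \<in> level X 0. x' \<subseteq> y} - {x}. g x'))"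
proof -
  have "(\<Sum>x'\<in>level X 0. joint_weight X m x x' * g x')
      = (\<Sum>x'\<in>level X 0 - {x}. \<Sum>y\<in>{y \<in> {y \<in> level X 1. x \<subseteq> y}. x' \<subseteq> y}. m y * g x')"
    by (rule sum.mono_neutral_cong_right)
       (auto simp: joint_weight_def skeleton_weight_def sum_distrib_right conj_assoc)
  also have "\<dots> = (\<Sum>y\<in>{y \<in> level X 1. x \<subseteq> y}. \<Sum>x'\<in>{x' \<in> level X 0 - {x}. x' \<subseteq> y}. m y * g x')"
    by (rule sum.swap_restrict) auto
  also have "\<dots> = (\<Sum>y\<in>{y \<in> level X 1. x \<subseteq> y}. m y * (\<Sum>x'\<in>{x' \<in> level X 0. x' \<subseteq> y} - {x}. g x'))"
    by (intro sum.cong refl) (auto simp: sum_distrib_left intro!: sum.cong)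
  finally show ?thesis .
qed

text \<open>The weight of a vertex shares out each plane's weight among its three vertices, hence
  the factor 3.\<close>

lemma sum_planes_at_vertex:
  assumes X: "grassmannian_complex X" and m: "standard_weight X m"
    and r: "complex_rank X \<ge> 1" and x: "x \<in> level X 0"
  shows "(\<Sum>y\<in>{y \<in> level X 1. x \<subseteq> y}. m y) = 3 * m x"
proof -
  have "m x = (\<Sum>y\<in>{y \<in> level X 1. x \<subset> y}. m y / real (card {x' \<in> level X 0. x' \<subset> y}))"
    using m r x unfolding standard_weight_def by force
  also have "\<dots> = (\<Sum>y\<in>{y \<in> level X 1. x \<subseteq> y}. m y / 3)"
  proof (intro sum.cong)
    show "{y \<in> level X 1. x \<subset> y} = {y \<in> level X 1. x \<subseteq> y}"
      using level_strict_subset_iff[OF x] by fastforce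
    fix y assume "y \<in> {y \<in> level X 1. x \<subseteq> y}"
    then have y: "y \<in> level X 1" by simp
    then have "{x' \<in> level X 0. x' \<subset> y} = {x' \<in> level X 0. x' \<subseteq> y}"
      using level_strict_subset_iff[of _ X 0 y 1] by auto
    then show "m y / real (card {x' \<in> level X 0. x' \<subset> y}) = m y / 3"
      using card_plane_vertices[OF X y] by simp
  qed
  finally show ?thesis by (simp flip: sum_divide_distrib)
qed

text \<open>Each plane through \<open>x\<close> holds two further vertices, which doubles the factor
  3.\<close>

lemma weighted_degree_skeleton_eq:
  assumes X: "grassmannian_complex X" and m: "standard_weight X m"
    and r: "complex_rank X \<ge> 1" and x: "x \<in> level X 0"
  shows "weighted_degree (skeleton_edges X) (skeleton_weight X m) x = 6 * m x"
proof -
  have "weighted_degree (skeleton_edges X) (skeleton_weight X m) x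
      = (\<Sum>y\<in>{y \<in> level X 1. x \<subseteq> y}. m y * (\<Sum>x'\<in>{x' \<in> level X 0. x' \<subseteq> y} - {x}. 1))"
    using weighted_degree_skeleton[OF x, of m] sum_joint_weight[of X m x "\<lambda>_. 1"] by simp
  also have "\<dots> = (\<Sum>y\<in>{y \<in> level X 1. x \<subseteq> y}. 2 * m y)"
    using card_plane_vertices[OF X] x by (intro sum.cong) auto
  also have "\<dots> = 6 * m x"
    using sum_planes_at_vertex[OF assms] by (simp flip: sum_distrib_left)
  finally show ?thesis .
qed

section \<open>The bound on codeword weights\<close>

theorem proposition22:
  fixes X :: "(bit ^ 'k) set set"
    and m :: "(bit ^ 'k) set \<Rightarrow> real"
    and c :: "(bit ^ 'k) set \<Rightarrow> bit"
    and lam :: real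
  assumes "grassmannian_complex X"
    and "standard_weight X m"
    and "complex_rank X \<ge> 1"
    and "vec.span (vertex_vector ` level X 0) = UNIV"
    and "\<forall>x\<in>level X 0. \<forall>y\<in>level X 0. m x = m y"
    and "lam = skeleton_expansion X m"
    and "lam < 1"
    and "c \<in> code X"
    and "c \<noteq> (\<lambda>_. 0)"
  shows "1 / 2 - lam / (2 * (1 - lam)) \<le> real (hamming_weight c) / real (card (level X 0)) \<and>
         real (hamming_weight c) / real (card (level X 0)) \<le> 1 / 2 + lam / (2 * (1 - lam))"
proof -
  note X = assms(1) and m = assms(2) and r = assms(3) and c = assms(8)
  let ?V = "level X 0"
  define n where "n = real (card ?V)"
  define W where "W = walk_entry (skeleton_edges X) (skeleton_weight X m)"
  define ind where "ind x = (if c x = 0 then 0 else 1::real)" for x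
  have supp: "{x. c x \<noteq> 0} = {x \<in> ?V. c x \<noteq> 0}"
    using c by (auto simp: code_def encode_def split: if_splits)
  define k where "k = real (hamming_weight c)"
  have k: "k = (\<Sum>x\<in>?V. ind x)"
    unfolding k_def hamming_weight_def supp by (simp add: ind_def sum.If_cases Int_def)
  have k0: "k > 0"
    using assms(9) by (auto simp: k_def hamming_weight_def card_gt_0_iff)
  \<comment> \<open>Together with \<open>k > 0\<close> this makes \<open>n\<close> positive, so that
    divisions by it are sound.\<close>
  have kn: "k \<le> n"
    unfolding k_def n_def hamming_weight_def supp by (simp add: card_mono)
  have m_vertex: "m x = 1 / n" if "x \<in> ?V" for x
  proof -
    have "(\<Sum>x'\<in>?V. m x') = 1" using m r unfolding standard_weight_def by auto
    moreover have "(\<Sum>x'\<in>?V. m x') = (\<Sum>x'\<in>?V. m x)" using assms(5) that by (intro sum.cong refl) blast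
    ultimately have "n * m x = 1" by (simp add: n_def)
    then show ?thesis by (simp add: eq_divide_eq mult.commute) auto
  qed
  have degree: "weighted_degree (skeleton_edges X) (skeleton_weight X m) x = 6 / n" if "x \<in> ?V" for x
    using weighted_degree_skeleton_eq[OF X m r that] m_vertex[OF that] by simp
  have W: "W x x' = joint_weight X m x x' * n / 6" if "x \<in> ?V" "x' \<in> ?V" for x x'
    using walk_entry_skeleton[OF that, of m] degree[OF that(1)] by (simp add: W_def)
  have sum_W: "(\<Sum>x'\<in>?V. W x x' * g x') = (\<Sum>x'\<in>?V. joint_weight X m x x' * g x') * n / 6"
    if "x \<in> ?V" for x g
    unfolding sum_distrib_right sum_divide_distrib by (intro sum.cong refl) (simp add: W that)
  have sym: "W x x' = W x' x" if "x \<in> ?V" "x' \<in> ?V" for x x'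
    using that by (simp add: W joint_weight_commute)
  have one: "(\<Sum>x'\<in>?V. W x x') = 1" if "x \<in> ?V" for x
  proof -
    have "(\<Sum>x'\<in>?V. joint_weight X m x x') = 6 / n"
      using weighted_degree_skeleton[OF that, of m] degree[OF that] by metis
    then show ?thesis using sum_W[OF that, of "\<lambda>_. 1"] k0 kn by simp
  qed
  \<comment> \<open>Each plane through a support vertex contributes exactly one further support
    vertex. The total is the plane weight \<open>3 / n\<close>, divided by the degree
    \<open>6 / n\<close>.\<close>
  have half: "(\<Sum>x'\<in>?V. W x x' * ind x') = 1 / 2" if x: "x \<in> ?V" "c x \<noteq> 0" for x
  proof -
    have "(\<Sum>x'\<in>?V. joint_weight X m x x' * ind x') = (\<Sum>y\<in>{y \<in> level X 1. x \<subseteq> y}. m y)"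
      unfolding sum_joint_weight using codeword_on_plane[OF X c _ x(1) _ x(2)]
      by (intro sum.cong) (auto simp: ind_def)
    also have "\<dots> = 3 / n" using sum_planes_at_vertex[OF X m r x(1)] m_vertex[OF x(1)] by simp
    finally show ?thesis using k0 kn by (simp add: sum_W[OF x(1)])
  qed
  define \<alpha> where "\<alpha> = k / n"
  have \<alpha>: "0 < \<alpha>" "\<alpha> \<le> 1" "k = \<alpha> * n" using k0 kn by (auto simp: \<alpha>_def)
  define f where "f x = ind x - \<alpha>" for x
  have sumf: "(\<Sum>x\<in>?V. f x) = 0"
    using \<alpha>(3) k by (simp add: f_def sum_subtractf n_def)
  have ind_sq: "ind x * ind x = ind x" for x by (simp add: ind_def)
  have norm_f: "(\<Sum>x\<in>?V. (f x)\<^sup>2) = \<alpha> * (1 - \<alpha>) * n"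
  proof -
    have "(\<Sum>x\<in>?V. (f x)\<^sup>2) = (\<Sum>x\<in>?V. (1 - 2 * \<alpha>) * ind x + \<alpha>\<^sup>2)"
      using ind_sq by (intro sum.cong) (auto simp: f_def power2_eq_square algebra_simps)
    also have "\<dots> = (1 - 2 * \<alpha>) * k + \<alpha>\<^sup>2 * n"
      by (simp add: sum.distrib k n_def flip: sum_distrib_left)
    finally show ?thesis using \<alpha>(3) by (simp add: power2_eq_square algebra_simps)
  qed
  have "(\<Sum>x\<in>?V. f x * (\<Sum>x'\<in>?V. W x x' * f x')) = \<alpha> * (1 / 2 - \<alpha>) * n"
  proof -
    have Wf: "(\<Sum>x'\<in>?V. W x x' * f x') = (\<Sum>x'\<in>?V. W x x' * ind x') - \<alpha>" if "x \<in> ?V" for x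
      using one[OF that] by (simp add: f_def right_diff_distrib sum_subtractf flip: sum_distrib_right)
    have "(\<Sum>x\<in>?V. \<Sum>x'\<in>?V. W x x' * f x') = (\<Sum>x'\<in>?V. \<Sum>x\<in>?V. W x x' * f x')"
      by (rule sum.swap)
    also have "\<dots> = (\<Sum>x'\<in>?V. (\<Sum>x\<in>?V. W x' x) * f x')"
      unfolding sum_distrib_right by (intro sum.cong refl) (simp add: sym)
    also have "\<dots> = 0" using sumf by (simp add: one)
    finally have s0: "(\<Sum>x\<in>?V. \<Sum>x'\<in>?V. W x x' * f x') = 0" .
    \<comment> \<open>As \<open>W f\<close> has sum 0, the constant \<open>\<alpha>\<close> in the
      left factor drops out. Only rows in the support remain, where \<open>half\<close> gives the
      value of \<open>W f\<close>.\<close>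
    have "(\<Sum>x\<in>?V. f x * (\<Sum>x'\<in>?V. W x x' * f x')) = (\<Sum>x\<in>?V. ind x * (\<Sum>x'\<in>?V. W x x' * f x'))"
      using s0 by (simp add: f_def left_diff_distrib sum_subtractf flip: sum_distrib_left)
    also have "\<dots> = (\<Sum>x\<in>?V. ind x * (1 / 2 - \<alpha>))"
    proof (intro sum.cong refl)
      fix x assume x: "x \<in> ?V"
      show "ind x * (\<Sum>x'\<in>?V. W x x' * f x') = ind x * (1 / 2 - \<alpha>)"
      proof (cases "c x = 0")
        case False
        then show ?thesis using Wf[OF x] half[OF x] by simp
      qed (simp add: ind_def)
    qed
    also have "\<dots> = k * (1 / 2 - \<alpha>)" by (simp add: k sum_distrib_right)
    finally show ?thesis using \<alpha>(3) by simp
  qed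
  moreover have "\<bar>\<Sum>x\<in>?V. f x * (\<Sum>x'\<in>?V. W x x' * f x')\<bar> \<le> lam * (\<Sum>x\<in>?V. (f x)\<^sup>2)"
    unfolding W_def assms(6) skeleton_expansion_def
    by (rule walk_quadratic_form_le)
       (use sym one sumf assms(6,7) in \<open>simp_all add: W_def skeleton_expansion_def\<close>)
  ultimately have "\<bar>1 / 2 - \<alpha>\<bar> * (\<alpha> * n) \<le> lam * (1 - \<alpha>) * (\<alpha> * n)"
    using \<alpha> k0 kn unfolding norm_f by (simp add: abs_mult mult_ac)
  moreover have "\<alpha> * n > 0" using k0 \<alpha>(3) by simp
  ultimately have key: "\<bar>1 / 2 - \<alpha>\<bar> \<le> lam * (1 - \<alpha>)" by (rule mult_right_le_imp_le)
  \<comment> \<open>At \<open>\<alpha> = 1\<close> the bound would read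
    \<open>1 / 2 \<le> 0\<close>. With \<open>1 - \<alpha>\<close> positive, the same bound makes
    \<open>lam\<close> nonnegative.\<close>
  have "\<alpha> \<noteq> 1" using key by auto
  moreover have "0 \<le> lam * (1 - \<alpha>)" using key by linarith
  ultimately have "0 \<le> lam" using \<alpha>(2) by (simp add: zero_le_mult_iff)
  \<comment> \<open>Multiplied by \<open>1 - lam\<close>, the goals become the next two
    inequalities. The lower one is \<open>key\<close> rearranged; the upper one is immediate for
    \<open>\<alpha> \<le> 1 / 2\<close>, and otherwise uses
    \<open>1 - \<alpha> \<le> \<alpha>\<close>.\<close>
  then have "0 \<le> lam * \<alpha>" and "\<alpha> \<le> 1 / 2 \<or> lam * (1 - \<alpha>) \<le> lam * \<alpha>"
    using \<alpha>(1) by (auto intro: mult_left_mono)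
  then have "\<alpha> - lam * \<alpha> \<le> 1 / 2" and "1 / 2 - lam \<le> \<alpha> - lam * \<alpha>"
    using key unfolding right_diff_distrib by linarith+
  then have "1 / 2 - lam / (2 * (1 - lam)) \<le> \<alpha> \<and> \<alpha> \<le> 1 / 2 + lam / (2 * (1 - lam))"
    using assms(7) by (simp add: field_simps)
  then show ?thesis by (simp add: \<alpha>_def k_def n_def)
qed

end
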